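(* Let $R=\{(0,0),(0,1),(0,2),(3,0),(1,1),(1,2),(1,3),(2,2),(3,2),(3,3)\}$ and $R'=\{(0,0),(1,0),(2,0),(0,3),(1,1),(2,1),(2,2),(2,3),(3,1),(3,3)\}$. Then $(123,R)\sim_{jd}(132,R)$ and $(123,R')\sim_{jd}(132,R')$.
   Context: $S_n$ is the set of permutations $\pi=\pi_1\cdots\pi_n$ of $\{1,\dots,n\}$. A mesh pattern of length $k$ is a pair $(\tau,R)$ with $\tau\in S_k$ and $R\subseteq\{0,\dots,k\}\times\{0,\dots,k\}$ (the set of shaded boxes; box $(a,b)$ is the unit square with lower-left corner $(a,b)$). An occurrence of $(\tau,R)$ in $\pi\in S_n$ is a subsequence $\pi_{i_1}\cdots\pi_{i_k}$, $i_1<\dots<i_k$, order-isomorphic to $\tau$, such that, with $i_0=0$, $i_{k+1}=n+1$, with $v_1<\dots<v_k$ the values $\pi_{i_1},\dots,\pi_{i_k}$ in increasing order, and $v_0=0$, $v_{k+1}=n+1$, for each $(a,b)\in R$ there is no index $m$ with $i_a<m<i_{a+1}$ and $v_b<\pi_m<v_{b+1}$. Two mesh patterns $q_1,q_2$ are jointly equidistributed, written $q_1\sim_{jd}q_2$, if for all nonnegative integers $n,k,\ell$ the number of $\pi\in S_n$ with exactly $k$ occurrences of $q_1$ and $\ell$ occurrences of $q_2$ equals the number of $\pi\in S_n$ with exactly $\ell$ occurrences of $q_1$ and $k$ occurrences of $q_2$. *)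

theory Defs
  imports "HOL-Combinatorics.Permutations"
begin

text \<open>
  The set \<open>S\<^sub>n\<close> is rendered as \<open>{\<pi>. \<pi> permutes {1..n}}\<close>, so that \<open>\<pi> m\<close> is the
  \<open>m\<close>-th letter of \<open>\<pi>\<close> (positions and values are counted from 1).
\<close>

datatype mesh_pattern =
  Mesh (pat_length: nat) (pat_perm: "nat \<Rightarrow> nat") (shading: "(nat \<times> nat) set")

definition is_mesh_pattern :: "mesh_pattern \<Rightarrow> bool" where
  "is_mesh_pattern q \<longleftrightarrow>
     pat_perm q permutes {1..pat_length q} \<and>
     shading q \<subseteq> {0..pat_length q} \<times> {0..pat_length q}"

text \<open>
  For \<open>A = {a\<^sub>1 < \<dots> < a\<^sub>k} \<subseteq> {1..n}\<close>, \<open>grid_line n A j\<close> is \<open>a\<^sub>j\<close>, with the boundary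
  conventions \<open>a\<^sub>0 = 0\<close> and \<open>a\<^bsub>k+1\<^esub> = n + 1\<close>. It is meaningful only for \<open>j \<le> k + 1\<close>.
\<close>

definition grid_line :: "nat \<Rightarrow> nat set \<Rightarrow> nat \<Rightarrow> nat" where
  "grid_line n A j = (0 # sorted_list_of_set A @ [n + 1]) ! j"

text \<open>
  A subsequence is identified with its set \<open>I\<close> of positions: \<open>grid_line n I\<close> enumerates the
  \<open>i\<^sub>j\<close> and \<open>grid_line n (\<pi> ` I)\<close> the sorted values \<open>v\<^sub>j\<close>.
\<close>

definition is_occurrence :: "mesh_pattern \<Rightarrow> nat \<Rightarrow> (nat \<Rightarrow> nat) \<Rightarrow> nat set \<Rightarrow> bool" where
  "is_occurrence q n \<pi> I \<longleftrightarrow>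
     I \<subseteq> {1..n} \<and> card I = pat_length q \<and>
     (\<forall>c\<in>{1..pat_length q}. \<forall>d\<in>{1..pat_length q}.
        pat_perm q c < pat_perm q d \<longleftrightarrow> \<pi> (grid_line n I c) < \<pi> (grid_line n I d)) \<and>
     (\<forall>(a, b)\<in>shading q.
        \<not> (\<exists>m\<in>{1..n}. grid_line n I a < m \<and> m < grid_line n I (a + 1) \<and>
             grid_line n (\<pi> ` I) b < \<pi> m \<and> \<pi> m < grid_line n (\<pi> ` I) (b + 1)))"

definition num_occurrences :: "mesh_pattern \<Rightarrow> nat \<Rightarrow> (nat \<Rightarrow> nat) \<Rightarrow> nat" where
  "num_occurrences q n \<pi> = card {I. is_occurrence q n \<pi> I}"

definition jointly_equidistributed :: "mesh_pattern \<Rightarrow> mesh_pattern \<Rightarrow> bool"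
    (infix "\<sim>\<^sub>j\<^sub>d" 50) where
  "q\<^sub>1 \<sim>\<^sub>j\<^sub>d q\<^sub>2 \<longleftrightarrow>
     (\<forall>n k l.
        card {\<pi>. \<pi> permutes {1..n} \<and> num_occurrences q\<^sub>1 n \<pi> = k \<and> num_occurrences q\<^sub>2 n \<pi> = l} =
        card {\<pi>. \<pi> permutes {1..n} \<and> num_occurrences q\<^sub>1 n \<pi> = l \<and> num_occurrences q\<^sub>2 n \<pi> = k})"

text \<open>The underlying permutations 123 and 132, written in one-line notation.\<close>

definition perm123 :: "nat \<Rightarrow> nat" where
  "perm123 = id(1 := 1, 2 := 2, 3 := 3)"

definition perm132 :: "nat \<Rightarrow> nat" where
  "perm132 = id(1 := 1, 2 := 3, 3 := 2)"

lemma perm123_permutes: "perm123 permutes {1..3}"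
proof -
  have "perm123 = id"
    by (auto simp: perm123_def)
  then show ?thesis
    by (simp add: permutes_id)
qed

lemma perm132_permutes: "perm132 permutes {1..3}"
proof -
  have "perm132 = transpose 2 3"
    by (auto simp: perm132_def transpose_def fun_eq_iff)
  moreover have "transpose 2 3 permutes {1..3::nat}"
    by (rule permutes_swap_id) auto
  ultimately show ?thesis
    by simp
qed

lemma is_mesh_pattern_123_132:
  assumes "R \<subseteq> {0..3} \<times> {0..3}"
  shows "is_mesh_pattern (Mesh 3 perm123 R)" "is_mesh_pattern (Mesh 3 perm132 R)"
  using assms perm123_permutes perm132_permutes by (auto simp: is_mesh_pattern_def)

end

theory Submission
  imports Defs
begin

text \<open>
  Exchanging the letters at the last two positions of an occurrence turns occurrences of
  \<open>(123, R)\<close> into occurrences of \<open>(132, R)\<close> and back, whatever \<open>R\<close> is, because the letters inside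
  the boxes do not move. Hence both patterns have the same total number of occurrences over \<open>S\<^sub>n\<close>.
  For the given \<open>R\<close> the first letter of an occurrence determines the occurrence, and two
  occurrences cannot have different first letters; so each pattern occurs at most once in a
  permutation. Equally many permutations thus contain the one and the other pattern, and removing
  those that contain both gives joint equidistribution. The set \<open>R'\<close> is the reflection of \<open>R\<close> in
  the diagonal, so the second claim follows by passing to inverse permutations.
\<close>

section \<open>Occurrences as triples of positions and values\<close>

definition empty_boxes ::
    "(nat \<times> nat) set \<Rightarrow> nat \<Rightarrow> (nat \<Rightarrow> nat) \<Rightarrow> nat list \<Rightarrow> nat list \<Rightarrow> bool" where
  "empty_boxes R n \<pi> xs ys \<longleftrightarrow>
     (\<forall>(a, b)\<in>R. \<forall>m\<in>{1..n}. \<not> (xs ! a < m \<and> m < xs ! (a + 1) \<and> ys ! b < \<pi> m \<and> \<pi> m < ys ! (b + 1)))"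

text \<open>The letters at \<open>a\<close>, \<open>b\<close>, \<open>c\<close> are not mentioned;
  only the values \<open>x < y < z\<close> bounding the boxes are. The predicate therefore serves
  123 and 132 alike, the difference being which letter is passed as \<open>y\<close> and which as
  \<open>z\<close>.\<close>

definition mesh_triple ::
    "(nat \<times> nat) set \<Rightarrow> nat \<Rightarrow> (nat \<Rightarrow> nat) \<Rightarrow> nat \<Rightarrow> nat \<Rightarrow> nat \<Rightarrow> nat \<Rightarrow> nat \<Rightarrow> nat \<Rightarrow> bool" where
  "mesh_triple R n \<pi> a b c x y z \<longleftrightarrow>
     1 \<le> a \<and> a < b \<and> b < c \<and> c \<le> n \<and> x < y \<and> y < z \<and>
     empty_boxes R n \<pi> [0, a, b, c, n + 1] [0, x, y, z, n + 1]"

lemma sorted_list_of_set_triple: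
  fixes a b c :: nat
  assumes "a < b" "b < c"
  shows "sorted_list_of_set {a, b, c} = [a, b, c]"
  using assms sorted_list_of_set.idem_if_sorted_distinct[of "[a, b, c]"] by simp

lemma card_3_sortedE:
  fixes I :: "nat set"
  assumes "card I = 3"
  obtains a b c where "I = {a, b, c}" "a < b" "b < c"
proof -
  have fin: "finite I"
    using assms by (auto intro: card_ge_0_finite)
  have "length (sorted_list_of_set I) = 3"
    using assms by simp
  then obtain a b c where abc: "sorted_list_of_set I = [a, b, c]"
    unfolding numeral_3_eq_3 length_Suc_conv by auto
  have "I = {a, b, c}"
    using set_sorted_list_of_set[OF fin] abc by simp
  moreover have "a < b" "b < c"
    using strict_sorted_list_of_set[of I] abc by auto
  ultimately show ?thesis
    using that by blast
qed

lemma grid_line_triple: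
  assumes "a < b" "b < c"
  shows "grid_line n {a, b, c} j = [0, a, b, c, n + 1] ! j"
  by (simp add: grid_line_def sorted_list_of_set_triple[OF assms])

lemma atLeastAtMost_1_3: "{1..3::nat} = {1, 2, 3}"
  by auto

lemma is_occurrence_123:
  "is_occurrence (Mesh 3 perm123 R) n \<pi> I \<longleftrightarrow>
     (\<exists>a b c. I = {a, b, c} \<and> mesh_triple R n \<pi> a b c (\<pi> a) (\<pi> b) (\<pi> c))" (is "?L \<longleftrightarrow> ?R")
proof -
  have *: "is_occurrence (Mesh 3 perm123 R) n \<pi> {a, b, c} \<longleftrightarrow>
      mesh_triple R n \<pi> a b c (\<pi> a) (\<pi> b) (\<pi> c)" if "a < b" "b < c" for a b c
  \<comment> \<open>Only when the letters are in the right order is the sorted list of values known;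
    otherwise the order conditions alone refute both sides.\<close>
  proof (cases "\<pi> a < \<pi> b \<and> \<pi> b < \<pi> c")
    case True
    then have "grid_line n (\<pi> ` {a, b, c}) j = [0, \<pi> a, \<pi> b, \<pi> c, n + 1] ! j" for j
      using grid_line_triple[of "\<pi> a" "\<pi> b" "\<pi> c"] by simp
    with True that show ?thesis
      unfolding is_occurrence_def mesh_triple_def empty_boxes_def mesh_pattern.sel
        atLeastAtMost_1_3 grid_line_triple[OF that]
      by (auto simp: perm123_def)
  next
    case False
    with that show ?thesis
      unfolding is_occurrence_def mesh_triple_def mesh_pattern.sel
        atLeastAtMost_1_3 grid_line_triple[OF that]
      by (auto simp: perm123_def)
  qed
  show ?thesis
  proof
    assume L: ?L
    then have "card I = 3"
      by (simp add: is_occurrence_def)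
    then obtain a b c where "I = {a, b, c}" "a < b" "b < c"
      by (rule card_3_sortedE)
    with L * show ?R by blast
  next
    assume ?R
    with * show ?L by (metis mesh_triple_def)
  qed
qed

lemma is_occurrence_132:
  "is_occurrence (Mesh 3 perm132 R) n \<pi> I \<longleftrightarrow>
     (\<exists>a b c. I = {a, b, c} \<and> mesh_triple R n \<pi> a b c (\<pi> a) (\<pi> c) (\<pi> b))" (is "?L \<longleftrightarrow> ?R")
proof -
  have *: "is_occurrence (Mesh 3 perm132 R) n \<pi> {a, b, c} \<longleftrightarrow>
      mesh_triple R n \<pi> a b c (\<pi> a) (\<pi> c) (\<pi> b)" if "a < b" "b < c" for a b c
  proof (cases "\<pi> a < \<pi> c \<and> \<pi> c < \<pi> b")
    case True
    \<comment> \<open>The values are listed increasingly, as \<open>grid_line_triple\<close>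
      requires.\<close>
    have "\<pi> ` {a, b, c} = {\<pi> a, \<pi> c, \<pi> b}"
      by auto
    with True have "grid_line n (\<pi> ` {a, b, c}) j = [0, \<pi> a, \<pi> c, \<pi> b, n + 1] ! j" for j
      using grid_line_triple[of "\<pi> a" "\<pi> c" "\<pi> b"] by simp
    with True that show ?thesis
      unfolding is_occurrence_def mesh_triple_def empty_boxes_def mesh_pattern.sel
        atLeastAtMost_1_3 grid_line_triple[OF that]
      by (auto simp: perm132_def)
  next
    case False
    with that show ?thesis
      unfolding is_occurrence_def mesh_triple_def mesh_pattern.sel
        atLeastAtMost_1_3 grid_line_triple[OF that]
      by (auto simp: perm132_def)
  qed
  show ?thesis
  proof
    assume L: ?L
    then have "card I = 3"
      by (simp add: is_occurrence_def)
    then obtain a b c where "I = {a, b, c}" "a < b" "b < c"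
      by (rule card_3_sortedE)
    with L * show ?R by blast
  next
    assume ?R
    with * show ?L by (metis mesh_triple_def)
  qed
qed

subsection \<open>Inverse permutations\<close>

text \<open>Inversion reflects the plot in the diagonal: positions and values trade places, and box
  \<open>(q, p)\<close> becomes \<open>(p, q)\<close>. The condition on the image puts
  \<open>x\<close> and \<open>z\<close> within \<open>{1..n}\<close>.\<close>

lemma mesh_triple_inverse:
  assumes \<pi>: "\<pi> permutes {1..n}" and "mesh_triple R n \<pi> a b c x y z"
    and "\<pi> ` {a, b, c} = {x, y, z}"
  shows "mesh_triple (R\<inverse>) n (inv \<pi>) x y z a b c"
proof -
  have abc: "1 \<le> a" "a < b" "b < c" "c \<le> n" "x < y" "y < z"
    and e: "empty_boxes R n \<pi> [0, a, b, c, n + 1] [0, x, y, z, n + 1]"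
    using assms(2) by (auto simp: mesh_triple_def)
  have "\<pi> ` {a, b, c} \<subseteq> {1..n}"
    using permutes_image[OF \<pi>] abc by fastforce
  then have "1 \<le> x" "z \<le> n"
    unfolding assms(3) by auto
  moreover have "empty_boxes (R\<inverse>) n (inv \<pi>) [0, x, y, z, n + 1] [0, a, b, c, n + 1]"
    unfolding empty_boxes_def
  proof clarify
    fix p q m
    assume h: "(q, p) \<in> R" "m \<in> {1..n}"
      "[0, x, y, z, n + 1] ! p < m" "m < [0, x, y, z, n + 1] ! (p + 1)"
      "[0, a, b, c, n + 1] ! q < inv \<pi> m" "inv \<pi> m < [0, a, b, c, n + 1] ! (q + 1)"
    \<comment> \<open>A point \<open>(m, inv \<pi> m)\<close> in a reflected box comes from the
      point \<open>(inv \<pi> m, m)\<close> of \<open>\<pi>\<close> in the original box.\<close>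
    have "inv \<pi> m \<in> {1..n}" "\<pi> (inv \<pi> m) = m"
      using permutes_in_image[OF permutes_inv[OF \<pi>]] permutes_inverses(1)[OF \<pi>] h(2) by blast+
    with e h show False
      unfolding empty_boxes_def by (metis (no_types, lifting) case_prodD)
  qed
  ultimately show ?thesis
    using abc by (simp add: mesh_triple_def)
qed

lemma is_occurrence_123_inverse:
  assumes \<pi>: "\<pi> permutes {1..n}" and "is_occurrence (Mesh 3 perm123 R) n \<pi> I"
  shows "is_occurrence (Mesh 3 perm123 (R\<inverse>)) n (inv \<pi>) (\<pi> ` I)"
proof -
  obtain a b c where I: "I = {a, b, c}" and t: "mesh_triple R n \<pi> a b c (\<pi> a) (\<pi> b) (\<pi> c)"
    using assms(2) is_occurrence_123 by auto
  have "mesh_triple (R\<inverse>) n (inv \<pi>) (\<pi> a) (\<pi> b) (\<pi> c) a b c"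
    using mesh_triple_inverse[OF \<pi> t] by auto
  then show ?thesis
    unfolding is_occurrence_123 I using permutes_inverses(2)[OF \<pi>]
    by (intro exI[of _ "\<pi> a"] exI[of _ "\<pi> b"] exI[of _ "\<pi> c"]) simp
qed

lemma is_occurrence_132_inverse:
  assumes \<pi>: "\<pi> permutes {1..n}" and "is_occurrence (Mesh 3 perm132 R) n \<pi> I"
  shows "is_occurrence (Mesh 3 perm132 (R\<inverse>)) n (inv \<pi>) (\<pi> ` I)"
proof -
  obtain a b c where I: "I = {a, b, c}" and t: "mesh_triple R n \<pi> a b c (\<pi> a) (\<pi> c) (\<pi> b)"
    using assms(2) is_occurrence_132 by auto
  have "mesh_triple (R\<inverse>) n (inv \<pi>) (\<pi> a) (\<pi> c) (\<pi> b) a b c"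
    using mesh_triple_inverse[OF \<pi> t] by auto
  then show ?thesis
    unfolding is_occurrence_132 I using permutes_inverses(2)[OF \<pi>]
    \<comment> \<open>As 132 is its own inverse, the positions in increasing order are
      \<open>\<pi> a\<close>, \<open>\<pi> c\<close>, \<open>\<pi> b\<close>, carrying the letters
      \<open>a\<close>, \<open>c\<close>, \<open>b\<close>.\<close>
    by (intro exI[of _ "\<pi> a"] exI[of _ "\<pi> c"] exI[of _ "\<pi> b"]) auto
qed

lemma num_occurrences_inverse:
  assumes \<pi>: "\<pi> permutes {1..n}"
    and inverse: "\<And>S \<sigma> I. \<lbrakk>\<sigma> permutes {1..n}; is_occurrence (Mesh k \<tau> S) n \<sigma> I\<rbrakk>
      \<Longrightarrow> is_occurrence (Mesh k \<tau> (S\<inverse>)) n (inv \<sigma>) (\<sigma> ` I)"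
  shows "num_occurrences (Mesh k \<tau> (R\<inverse>)) n (inv \<pi>) = num_occurrences (Mesh k \<tau> R) n \<pi>"
proof -
  have id: "\<pi> ` inv \<pi> ` I = I" "inv \<pi> ` \<pi> ` I = I" for I
    using permutes_inverses[OF \<pi>] by (auto simp: image_image)
  have "bij_betw (image \<pi>) {I. is_occurrence (Mesh k \<tau> R) n \<pi> I}
      {I. is_occurrence (Mesh k \<tau> (R\<inverse>)) n (inv \<pi>) I}"
  proof (rule bij_betw_byWitness[where f' = "image (inv \<pi>)"])
    \<comment> \<open>The assumption \<open>inverse\<close> ranges over all shadings and
      permutations, so it also applies to \<open>R\<inverse>\<close> and \<open>inv \<pi>\<close>
      and leads back to \<open>R\<close> and \<open>\<pi>\<close>.\<close>
    show "image (inv \<pi>) ` {I. is_occurrence (Mesh k \<tau> (R\<inverse>)) n (inv \<pi>) I}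
        \<subseteq> {I. is_occurrence (Mesh k \<tau> R) n \<pi> I}"
      using inverse[OF permutes_inv[OF \<pi>], of "R\<inverse>"] permutes_inv_inv[OF \<pi>] by auto
  qed (use inverse[OF \<pi>] id in auto)
  then show ?thesis
    unfolding num_occurrences_def by (simp add: bij_betw_same_card)
qed

lemma jointly_equidistributed_inverse:
  assumes "p\<^sub>1 \<sim>\<^sub>j\<^sub>d p\<^sub>2"
    and 1: "\<And>n \<pi>. \<pi> permutes {1..n} \<Longrightarrow> num_occurrences q\<^sub>1 n (inv \<pi>) = num_occurrences p\<^sub>1 n \<pi>"
    and 2: "\<And>n \<pi>. \<pi> permutes {1..n} \<Longrightarrow> num_occurrences q\<^sub>2 n (inv \<pi>) = num_occurrences p\<^sub>2 n \<pi>"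
  shows "q\<^sub>1 \<sim>\<^sub>j\<^sub>d q\<^sub>2"
proof -
  have "card {\<pi>. \<pi> permutes {1..n} \<and> num_occurrences q\<^sub>1 n \<pi> = k \<and> num_occurrences q\<^sub>2 n \<pi> = l} =
      card {\<pi>. \<pi> permutes {1..n} \<and> num_occurrences p\<^sub>1 n \<pi> = k \<and> num_occurrences p\<^sub>2 n \<pi> = l}"
    for n k l
    by (rule bij_betw_same_card[of inv], rule bij_betw_byWitness[where f' = inv])
      (use 1[OF permutes_inv, of _ n] 2[OF permutes_inv, of _ n] 1[of _ n] 2[of _ n]
        in \<open>auto simp: permutes_inv permutes_inv_inv\<close>)
  with assms(1) show ?thesis
    by (simp add: jointly_equidistributed_def)
qed

subsection \<open>Exchanging the last two letters of an occurrence\<close>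

lemma empty_boxes_cong:
  assumes "\<And>m. m \<notin> {a, b, c} \<Longrightarrow> \<pi> m = \<sigma> m" "a < b" "b < c"
    and "R \<subseteq> {0..3} \<times> {0..3}"
    and "empty_boxes R n \<pi> [0, a, b, c, n + 1] ys"
  shows "empty_boxes R n \<sigma> [0, a, b, c, n + 1] ys"
  unfolding empty_boxes_def
proof clarify
  fix p q m
  assume h: "(p, q) \<in> R" "m \<in> {1..n}"
    "[0, a, b, c, n + 1] ! p < m" "m < [0, a, b, c, n + 1] ! (p + 1)"
    "ys ! q < \<sigma> m" "\<sigma> m < ys ! (q + 1)"
  \<comment> \<open>The bound on \<open>R\<close> leaves four columns, and a position strictly
    between neighbouring grid lines is none of \<open>a\<close>, \<open>b\<close>,
    \<open>c\<close>.\<close>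
  have "p \<in> {0, 1, 2, 3}"
    using h(1) assms(4) by auto
  then have "m \<notin> {a, b, c}"
    using h(3,4) assms(2,3) by auto
  then have "\<pi> m = \<sigma> m"
    by (rule assms(1))
  with h assms(5) show False
    unfolding empty_boxes_def by (metis (no_types, lifting) case_prodD)
qed

lemma mesh_triple_transpose:
  assumes "mesh_triple R n \<pi> a b c x y z" "R \<subseteq> {0..3} \<times> {0..3}"
  shows "mesh_triple R n (\<pi> \<circ> transpose b c) a b c x y z"
  using assms empty_boxes_cong[of a b c \<pi> "\<pi> \<circ> transpose b c"] by (auto simp: mesh_triple_def)

text \<open>Acting on permutations with a marked occurrence avoids choosing one, and keeping
  \<open>I\<close> makes the map an involution. Index 0 of \<open>grid_line\<close> is the boundary,
  so 2 and 3 are the last two positions.\<close>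

definition swap_last :: "nat \<Rightarrow> (nat \<Rightarrow> nat) \<times> nat set \<Rightarrow> (nat \<Rightarrow> nat) \<times> nat set" where
  "swap_last n = (\<lambda>(\<pi>, I). (\<pi> \<circ> transpose (grid_line n I 2) (grid_line n I 3), I))"

lemma swap_last_triple:
  assumes "a < b" "b < c"
  shows "swap_last n (\<pi>, {a, b, c}) = (\<pi> \<circ> transpose b c, {a, b, c})"
  by (simp add: swap_last_def grid_line_triple[OF assms])

lemma swap_last_involution: "swap_last n (swap_last n p) = p"
  by (cases p) (simp add: swap_last_def comp_assoc)

lemma swap_last_permutes:
  assumes "is_occurrence q n \<pi> {a, b, c}" "\<pi> permutes {1..n}"
  shows "\<pi> \<circ> transpose b c permutes {1..n}"
  using assms by (auto simp: is_occurrence_def intro!: permutes_compose permutes_swap_id)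

lemma bij_betw_swap_last:
  assumes R: "R \<subseteq> {0..3} \<times> {0..3}"
  shows "bij_betw (swap_last n)
    {(\<pi>, I). \<pi> permutes {1..n} \<and> is_occurrence (Mesh 3 perm123 R) n \<pi> I}
    {(\<pi>, I). \<pi> permutes {1..n} \<and> is_occurrence (Mesh 3 perm132 R) n \<pi> I}" (is "bij_betw _ ?A ?B")
proof (rule bij_betw_byWitness[where f' = "swap_last n"])
  show "swap_last n ` ?A \<subseteq> ?B"
  proof clarify
    fix \<pi> I \<sigma> J
    assume "\<pi> permutes {1..n}" and o: "is_occurrence (Mesh 3 perm123 R) n \<pi> I"
      and s: "(\<sigma>, J) = swap_last n (\<pi>, I)"
    obtain a b c where I: "I = {a, b, c}" and t: "mesh_triple R n \<pi> a b c (\<pi> a) (\<pi> b) (\<pi> c)"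
      using o is_occurrence_123 by auto
    then have ab: "a < b" "b < c"
      by (auto simp: mesh_triple_def)
    have [simp]: "J = {a, b, c}" and \<sigma>: "\<sigma> = \<pi> \<circ> transpose b c"
      using s I swap_last_triple[OF ab] by auto
    have "\<sigma> a = \<pi> a" "\<sigma> c = \<pi> b" "\<sigma> b = \<pi> c"
      using ab \<sigma> by auto
    then have "mesh_triple R n \<sigma> a b c (\<sigma> a) (\<sigma> c) (\<sigma> b)"
      using mesh_triple_transpose[OF t R] \<sigma> by simp
    then have "is_occurrence (Mesh 3 perm132 R) n \<sigma> J"
      unfolding is_occurrence_132 by auto
    with swap_last_permutes[of _ n \<pi> a b c] \<open>\<pi> permutes _\<close> o I \<sigma>
    show "\<sigma> permutes {1..n} \<and> is_occurrence (Mesh 3 perm132 R) n \<sigma> J"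
      by auto
  qed
  show "swap_last n ` ?B \<subseteq> ?A"
  proof clarify
    fix \<pi> I \<sigma> J
    assume "\<pi> permutes {1..n}" and o: "is_occurrence (Mesh 3 perm132 R) n \<pi> I"
      and s: "(\<sigma>, J) = swap_last n (\<pi>, I)"
    obtain a b c where I: "I = {a, b, c}" and t: "mesh_triple R n \<pi> a b c (\<pi> a) (\<pi> c) (\<pi> b)"
      using o is_occurrence_132 by auto
    then have ab: "a < b" "b < c"
      by (auto simp: mesh_triple_def)
    have [simp]: "J = {a, b, c}" and \<sigma>: "\<sigma> = \<pi> \<circ> transpose b c"
      using s I swap_last_triple[OF ab] by auto
    have "\<sigma> a = \<pi> a" "\<sigma> c = \<pi> b" "\<sigma> b = \<pi> c"
      using ab \<sigma> by auto
    then have "mesh_triple R n \<sigma> a b c (\<sigma> a) (\<sigma> b) (\<sigma> c)"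
      using mesh_triple_transpose[OF t R] \<sigma> by simp
    then have "is_occurrence (Mesh 3 perm123 R) n \<sigma> J"
      unfolding is_occurrence_123 by auto
    with swap_last_permutes[of _ n \<pi> a b c] \<open>\<pi> permutes _\<close> o I \<sigma>
    show "\<sigma> permutes {1..n} \<and> is_occurrence (Mesh 3 perm123 R) n \<sigma> J"
      by auto
  qed
qed (simp_all add: swap_last_involution)

subsection \<open>Patterns occurring at most once\<close>

definition occurs_at_most_once :: "mesh_pattern \<Rightarrow> bool" where
  "occurs_at_most_once q \<longleftrightarrow>
     (\<forall>n \<pi> I J. \<pi> permutes {1..n} \<longrightarrow> is_occurrence q n \<pi> I \<longrightarrow> is_occurrence q n \<pi> J \<longrightarrow> I = J)"

lemma num_occurrences_at_most_once:
  assumes "occurs_at_most_once q" "\<pi> permutes {1..n}"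
  shows "num_occurrences q n \<pi> = (if \<exists>I. is_occurrence q n \<pi> I then 1 else 0)"
proof (cases "\<exists>I. is_occurrence q n \<pi> I")
  case True
  then obtain I where "is_occurrence q n \<pi> I" ..
  with assms have "{I. is_occurrence q n \<pi> I} = {I}"
    unfolding occurs_at_most_once_def by blast
  with True show ?thesis
    by (simp add: num_occurrences_def)
qed (simp add: num_occurrences_def)

text \<open>Forgetting the marked occurrence is injective, because a permutation determines
  it.\<close>

lemma card_permutations_with_occurrence:
  assumes "occurs_at_most_once q"
  shows "card {\<pi>. \<pi> permutes {1..n} \<and> num_occurrences q n \<pi> = 1} =
    card {(\<pi>, I). \<pi> permutes {1..n} \<and> is_occurrence q n \<pi> I}" (is "card ?A = card ?P")
proof -
  have "inj_on fst ?P"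
  proof (rule inj_onI, clarify)
    fix \<pi> \<sigma> I J
    assume "\<pi> permutes {1..n}" "is_occurrence q n \<pi> I" "is_occurrence q n \<sigma> J"
      "fst (\<pi>, I) = fst (\<sigma>, J)"
    then show "\<pi> = \<sigma> \<and> I = J"
      using assms unfolding occurs_at_most_once_def fst_conv by blast
  qed
  moreover have "fst ` ?P = ?A"
  proof -
    have "num_occurrences q n \<pi> = 1 \<longleftrightarrow> (\<exists>I. is_occurrence q n \<pi> I)" if "\<pi> permutes {1..n}" for \<pi>
      using num_occurrences_at_most_once[OF assms that] by simp
    then show ?thesis
      unfolding fst_eq_Domain Domain_unfold by auto
  qed
  ultimately show ?thesis
    using card_image[of fst ?P] by simp
qed

lemma jointly_equidistributed_at_most_once:
  assumes q: "occurs_at_most_once q\<^sub>1" "occurs_at_most_once q\<^sub>2"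
    and card: "\<And>n. card {(\<pi>, I). \<pi> permutes {1..n} \<and> is_occurrence q\<^sub>1 n \<pi> I} =
      card {(\<pi>, I). \<pi> permutes {1..n} \<and> is_occurrence q\<^sub>2 n \<pi> I}"
  shows "q\<^sub>1 \<sim>\<^sub>j\<^sub>d q\<^sub>2"
  unfolding jointly_equidistributed_def
proof (intro allI)
  fix n k l :: nat
  let ?N = "\<lambda>k l. {\<pi>. \<pi> permutes {1..n} \<and> num_occurrences q\<^sub>1 n \<pi> = k \<and> num_occurrences q\<^sub>2 n \<pi> = l}"
  have le: "num_occurrences q\<^sub>1 n \<pi> \<le> 1" "num_occurrences q\<^sub>2 n \<pi> \<le> 1" if "\<pi> permutes {1..n}" for \<pi>
    using num_occurrences_at_most_once[OF q(1) that] num_occurrences_at_most_once[OF q(2) that]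
    by auto
  have fin: "finite (?N i j)" for i j
    by (rule finite_subset[OF _ finite_permutations[of "{1..n}"]]) auto
  \<comment> \<open>The permutations containing both patterns, \<open>?N 1 1\<close>, are common to
    the two counts and cancel.\<close>
  have "{\<pi>. \<pi> permutes {1..n} \<and> num_occurrences q\<^sub>1 n \<pi> = 1} = ?N 1 0 \<union> ?N 1 1"
    "{\<pi>. \<pi> permutes {1..n} \<and> num_occurrences q\<^sub>2 n \<pi> = 1} = ?N 0 1 \<union> ?N 1 1"
    using le by (fastforce simp: le_Suc_eq)+
  moreover have "card (?N 1 0 \<union> ?N 1 1) = card (?N 1 0) + card (?N 1 1)"
    "card (?N 0 1 \<union> ?N 1 1) = card (?N 0 1) + card (?N 1 1)"
    by (rule card_Un_disjoint[OF fin fin]; auto)+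
  ultimately have swap: "card (?N 1 0) = card (?N 0 1)"
    using card[of n] card_permutations_with_occurrence[OF q(1), of n]
      card_permutations_with_occurrence[OF q(2), of n] by simp
  consider "k = l" | "k = 1" "l = 0" | "k = 0" "l = 1" | "k > 1 \<or> l > 1"
    by linarith
  then show "card (?N k l) = card (?N l k)"
  proof cases
    case 4
    have "?N i j = {}" if "1 < i \<or> 1 < j" for i j
      using le that by (auto simp: not_less[symmetric])
    then have "?N k l = {}" "?N l k = {}"
      using 4 by blast+
    then show ?thesis by metis
  qed (use swap in auto)
qed

section \<open>At most one occurrence for the given shading\<close>

context
  fixes R :: "(nat \<times> nat) set"
  assumes R: "R = {(0,0),(0,1),(0,2),(3,0),(1,1),(1,2),(1,3),(2,2),(3,2),(3,3)}"
begin

text \<open>This reads the shading column by column. Outside the columns' boundary lines, column 0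
  is open only in its top box, column 1 only in its bottom box, column 3 only in box
  \<open>(3, 1)\<close>; column 2 is closed in box \<open>(2, 2)\<close>. The unordered
  \<open>{\<pi> b, \<pi> c}\<close> covers both patterns.\<close>

lemma mesh_triple_regions:
  assumes \<pi>: "\<pi> permutes {1..n}" and t: "mesh_triple R n \<pi> a b c x y z"
    and img: "\<pi> a = x" "{\<pi> b, \<pi> c} = {y, z}"
  shows "\<And>m. \<lbrakk>1 \<le> m; m < a\<rbrakk> \<Longrightarrow> z < \<pi> m"
    and "\<And>m. \<lbrakk>a < m; m < b\<rbrakk> \<Longrightarrow> \<pi> m < x"
    and "\<And>m. \<lbrakk>b < m; m < c\<rbrakk> \<Longrightarrow> \<not> (y < \<pi> m \<and> \<pi> m < z)"
    and "\<And>m. \<lbrakk>c < m; m \<le> n\<rbrakk> \<Longrightarrow> x < \<pi> m \<and> \<pi> m < y"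
proof -
  have abc: "1 \<le> a" "a < b" "b < c" "c \<le> n" "x < y" "y < z"
    and e: "empty_boxes R n \<pi> [0, a, b, c, n + 1] [0, x, y, z, n + 1]"
    using t by (auto simp: mesh_triple_def)
  have ran: "1 \<le> \<pi> m" "\<pi> m \<le> n" if "1 \<le> m" "m \<le> n" for m
    using permutes_in_image[OF \<pi>, of m] that by auto
  \<comment> \<open>By injectivity no other point lies on a horizontal grid line, so each lies
    inside a box.\<close>
  have new: "\<pi> m \<noteq> x \<and> \<pi> m \<noteq> y \<and> \<pi> m \<noteq> z" if "m \<noteq> a" "m \<noteq> b" "m \<noteq> c" for m
    using that img permutes_inj[OF \<pi>] by (metis doubleton_eq_iff injD)
  have box: "\<not> ([0, a, b, c, n + 1] ! p < m \<and> m < [0, a, b, c, n + 1] ! (p + 1) \<and>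
      [0, x, y, z, n + 1] ! q < \<pi> m \<and> \<pi> m < [0, x, y, z, n + 1] ! (q + 1))"
    if "(p, q) \<in> R" "1 \<le> m" "m \<le> n" for p q m
    using e that unfolding empty_boxes_def by fastforce
  show "z < \<pi> m" if "1 \<le> m" "m < a" for m
    using box[of 0 0 m] box[of 0 1 m] box[of 0 2 m] ran[of m] new[of m] that abc
    by (auto simp: R)
  show "\<pi> m < x" if "a < m" "m < b" for m
    using box[of 1 1 m] box[of 1 2 m] box[of 1 3 m] ran[of m] new[of m] that abc
    by (auto simp: R)
  show "\<not> (y < \<pi> m \<and> \<pi> m < z)" if "b < m" "m < c" for m
    using box[of 2 2 m] that abc by (auto simp: R)
  show "x < \<pi> m \<and> \<pi> m < y" if "c < m" "m \<le> n" for m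
    using box[of 3 0 m] box[of 3 2 m] box[of 3 3 m] ran[of m] new[of m] that abc
    by (auto simp: R)
qed

lemma mesh_triple_first_unique:
  assumes \<pi>: "\<pi> permutes {1..n}"
    and t: "mesh_triple R n \<pi> a b c (\<pi> a) y z" "{\<pi> b, \<pi> c} = {y, z}"
    and t': "mesh_triple R n \<pi> a' b' c' (\<pi> a') y' z'" "{\<pi> b', \<pi> c'} = {y', z'}"
  shows "\<not> a < a'"
proof
  assume "a < a'"
  have o: "1 \<le> a" "c \<le> n" "\<pi> a < y" "y < z" "c' \<le> n" "\<pi> a' < y'" "y' < z'"
    using t(1) t'(1) by (auto simp: mesh_triple_def)
  have c: "\<pi> c \<ge> y" "\<pi> c' \<le> z'"
    using t(2) t'(2) o by (auto simp: doubleton_eq_iff)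
  \<comment> \<open>Position \<open>a\<close> is in column 0 of the second triple, so the first
    triple lies entirely above the second. Then neither of \<open>c\<close>, \<open>c'\<close> can
    be right of the other: \<open>c\<close> in the last column of the second triple would be too
    high, \<open>c'\<close> in that of the first too low.\<close>
  have "z' < \<pi> a"
    using mesh_triple_regions(1)[OF \<pi> t'(1) refl t'(2)] o \<open>a < a'\<close> by auto
  have "\<not> c' < c"
    using mesh_triple_regions(4)[OF \<pi> t'(1) refl t'(2), of c] o c \<open>z' < \<pi> a\<close> by auto
  moreover have "c \<noteq> c'"
    using o c \<open>z' < \<pi> a\<close> by auto
  ultimately show False
    using mesh_triple_regions(4)[OF \<pi> t(1) refl t(2), of c'] o c \<open>z' < \<pi> a\<close> by auto
qed

text \<open>If \<open>b\<close> were left of \<open>b'\<close>, it would fall in column 1 of the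
  second triple, forcing its letter below \<open>\<pi> a\<close>.\<close>

lemma mesh_triple_second_unique:
  assumes \<pi>: "\<pi> permutes {1..n}"
    and t: "mesh_triple R n \<pi> a b c (\<pi> a) y z" "{\<pi> b, \<pi> c} = {y, z}"
    and t': "mesh_triple R n \<pi> a b' c' (\<pi> a) y' z'" "{\<pi> b', \<pi> c'} = {y', z'}"
  shows "\<not> b < b'"
proof
  assume "b < b'"
  have "a < b" "\<pi> a < y" "y < z"
    using t(1) by (auto simp: mesh_triple_def)
  moreover have "\<pi> b \<ge> y"
    using t(2) \<open>y < z\<close> by (auto simp: doubleton_eq_iff)
  ultimately show False
    using mesh_triple_regions(2)[OF \<pi> t'(1) refl t'(2), of b] \<open>b < b'\<close> by auto
qed

lemma occurs_at_most_once_123: "occurs_at_most_once (Mesh 3 perm123 R)"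
  unfolding occurs_at_most_once_def is_occurrence_123
proof (intro allI impI, elim exE conjE)
  fix n \<pi> I J a b c a' b' c'
  assume \<pi>: "\<pi> permutes {1..n}" and IJ: "I = {a, b, c}" "J = {a', b', c'}"
    and t: "mesh_triple R n \<pi> a b c (\<pi> a) (\<pi> b) (\<pi> c)"
    and t': "mesh_triple R n \<pi> a' b' c' (\<pi> a') (\<pi> b') (\<pi> c')"
  have [simp]: "a' = a"
    using mesh_triple_first_unique[OF \<pi> t refl t' refl]
      mesh_triple_first_unique[OF \<pi> t' refl t refl] by simp
  have [simp]: "b' = b"
    using mesh_triple_second_unique[OF \<pi> t refl] mesh_triple_second_unique[OF \<pi> t' refl] t t'
    by (metis \<open>a' = a\<close> linorder_neqE_nat)
  \<comment> \<open>Here \<open>y\<close> is \<open>\<pi> b\<close> in both triples. The later of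
    \<open>c\<close>, \<open>c'\<close> lies in the last column of the other triple, so its letter
    would be below \<open>\<pi> b\<close>.\<close>
  have "\<pi> b < \<pi> c" "\<pi> b < \<pi> c'" "c \<le> n" "c' \<le> n"
    using t t' by (auto simp: mesh_triple_def)
  then have "c' = c"
    using mesh_triple_regions(4)[OF \<pi> t refl refl, of c']
      mesh_triple_regions(4)[OF \<pi> t' refl refl, of c] by force
  with IJ show "I = J" by simp
qed

lemma occurs_at_most_once_132: "occurs_at_most_once (Mesh 3 perm132 R)"
  unfolding occurs_at_most_once_def is_occurrence_132
proof (intro allI impI, elim exE conjE)
  fix n \<pi> I J a b c a' b' c'
  assume \<pi>: "\<pi> permutes {1..n}" and IJ: "I = {a, b, c}" "J = {a', b', c'}"
    and t: "mesh_triple R n \<pi> a b c (\<pi> a) (\<pi> c) (\<pi> b)"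
    and t': "mesh_triple R n \<pi> a' b' c' (\<pi> a') (\<pi> c') (\<pi> b')"
  \<comment> \<open>For 132 the roles are \<open>y = \<pi> c\<close> and \<open>z = \<pi> b\<close>,
    so the pair appears in the opposite order.\<close>
  note comm = insert_commute[of _ _ "{}"]
  have [simp]: "a' = a"
    using mesh_triple_first_unique[OF \<pi> t comm t' comm]
      mesh_triple_first_unique[OF \<pi> t' comm t comm] by simp
  have [simp]: "b' = b"
    using mesh_triple_second_unique[OF \<pi> t comm] mesh_triple_second_unique[OF \<pi> t' comm] t t'
      comm
    by (metis \<open>a' = a\<close> linorder_neqE_nat)
  have o: "b < c" "b < c'" "\<pi> c < \<pi> b" "\<pi> c' < \<pi> b" "c \<le> n" "c' \<le> n"
    using t t' by (auto simp: mesh_triple_def)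
  \<comment> \<open>If \<open>c < c'\<close>, the last column of the first triple gives
    \<open>\<pi> c' < \<pi> c\<close>. But then \<open>c\<close>, lying between \<open>b\<close> and
    \<open>c'\<close> with \<open>\<pi> c' < \<pi> c < \<pi> b\<close>, is a point in the shaded box
    \<open>(2, 2)\<close> of the second triple.\<close>
  have "\<not> c < c'"
    using mesh_triple_regions(4)[OF \<pi> t refl comm, of c']
      mesh_triple_regions(3)[OF \<pi> t' refl comm, of c] o by auto
  moreover have "\<not> c' < c"
    using mesh_triple_regions(4)[OF \<pi> t' refl comm, of c]
      mesh_triple_regions(3)[OF \<pi> t refl comm, of c'] o by auto
  ultimately have "c' = c" by simp
  with IJ show "I = J" by simp
qed

lemma jointly_equidistributed_123_132: "Mesh 3 perm123 R \<sim>\<^sub>j\<^sub>d Mesh 3 perm132 R"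
  by (rule jointly_equidistributed_at_most_once[OF occurs_at_most_once_123 occurs_at_most_once_132],
    rule bij_betw_same_card[OF bij_betw_swap_last]) (auto simp: R)

end

theorem theorem3p9:
  fixes R R' :: "(nat \<times> nat) set"
  assumes "R = {(0,0),(0,1),(0,2),(3,0),(1,1),(1,2),(1,3),(2,2),(3,2),(3,3)}"
    and "R' = {(0,0),(1,0),(2,0),(0,3),(1,1),(2,1),(2,2),(2,3),(3,1),(3,3)}"
  shows "Mesh 3 perm123 R \<sim>\<^sub>j\<^sub>d Mesh 3 perm132 R \<and> Mesh 3 perm123 R' \<sim>\<^sub>j\<^sub>d Mesh 3 perm132 R'"
proof -
  have jd: "Mesh 3 perm123 R \<sim>\<^sub>j\<^sub>d Mesh 3 perm132 R"
    by (rule jointly_equidistributed_123_132[OF assms(1)])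
  have "R' = R\<inverse>"
    unfolding assms by auto
  then have "Mesh 3 perm123 R' \<sim>\<^sub>j\<^sub>d Mesh 3 perm132 R'"
    using jointly_equidistributed_inverse[OF jd]
      num_occurrences_inverse[OF _ is_occurrence_123_inverse]
      num_occurrences_inverse[OF _ is_occurrence_132_inverse] by simp
  with jd show ?thesis ..
qed

end
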